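(* Let $1\le m\le n$ be an integer batch-size, and let $B=B_m$ and $B_\mu=B_{\mu,m}$ be the mini-batch operators. For any two functions $J:\mathcal{S}\to\mathbb{R}$ and $J':\mathcal{S}\to\mathbb{R}$ and for any stationary policy $\mu$, if $J\le J'$ (pointwise on $\mathcal{S}$), then $B^kJ\le B^kJ'$ and $B_\mu^kJ\le B_\mu^kJ'$ (pointwise on $\mathcal{S}$) for $k=1,2,\dots$.
   Context: A (finite, discounted) Markov decision process is a tuple $(\mathcal{S},\mathcal{U},P,g,\alpha)$ with finite state space $\mathcal{S}=\{1,\dots,n\}$, finite control space $\mathcal{U}$, nonempty subsets $\mathcal{U}(i)\subseteq\mathcal{U}$ of controls associated with each state $i$, transition probabilities $p_{ij}(u)\in[0,1]$ (probability of moving from state $i$ to state $j$ under control $u\in\mathcal{U}(i)$, so $\sum_{j\in\mathcal{S}}p_{ij}(u)=1$), stage cost $g:\mathcal{S}\times\mathcal{U}\to\mathbb{R}$, and discount factor $\alpha\in(0,1)$. Fix such an MDP. A stationary (admissible) policy is a map $\mu:\mathcal{S}\to\mathcal{U}$ with $\mu(i)\in\mathcal{U}(i)$ for all $i$. Mini-batch operators: for an integer batch-size $1\le m\le n$, let $\mathcal{M}_m(i)=\{j\in\mathbb{N}: 1\le j\le m\lfloor (i-1)/m\rfloor\}$ (empty if $\lfloor (i-1)/m\rfloor=0$), so $\mathcal{M}_m(i)\subseteq\{1,\dots,i-1\}$. For $J:\mathcal{S}\to\mathbb{R}$, the functions $B_mJ,B_{\mu,m}J:\mathcal{S}\to\mathbb{R}$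 are defined recursively in increasing $i$ by $$(B_mJ)(i)=\min_{u\in\mathcal{U}(i)}\left[g(i,u)+\alpha\sum_{j\in\mathcal{S}\setminus\mathcal{M}_m(i)}p_{ij}(u)J(j)+\alpha\sum_{j\in\mathcal{M}_m(i)}p_{ij}(u)(B_mJ)(j)\right],$$ $$(B_{\mu,m}J)(i)=g(i,\mu(i))+\alpha\sum_{j\in\mathcal{S}\setminus\mathcal{M}_m(i)}p_{ij}(\mu(i))J(j)+\alpha\sum_{j\in\mathcal{M}_m(i)}p_{ij}(\mu(i))(B_{\mu,m}J)(j).$$ A superscript $k$ on an operator denotes its $k$-fold composition with itself. *)

theory Defs
  imports Complex_Main
begin

text \<open>
  States are the natural numbers in \<open>{1..n}\<close>. Functions on the state space are represented by
  functions on \<^typ>\<open>nat\<close>; their values outside \<open>{1..n}\<close> carry no meaning and do not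
  influence the values of the operators below on \<open>{1..n}\<close>.
  \<open>U\<close> is the control space, \<open>A i\<close> the set of controls available at state \<open>i\<close>, and
  \<open>p i j u\<close> the probability of moving from \<open>i\<close> to \<open>j\<close> under control \<open>u\<close>.
  The stage cost \<open>g\<close> is unconstrained, so it is not an argument of the locale predicate.
\<close>

locale mdp =
  fixes n :: nat
    and U :: "'u set"
    and A :: "nat \<Rightarrow> 'u set"
    and p :: "nat \<Rightarrow> nat \<Rightarrow> 'u \<Rightarrow> real"
    and g :: "nat \<Rightarrow> 'u \<Rightarrow> real"
    and \<alpha> :: real
  assumes finite_controls: "finite U"
    and available_subset: "i \<in> {1..n} \<Longrightarrow> A i \<subseteq> U"
    and available_nonempty: "i \<in> {1..n} \<Longrightarrow> A i \<noteq> {}"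
    and prob_range: "\<lbrakk>i \<in> {1..n}; j \<in> {1..n}; u \<in> A i\<rbrakk> \<Longrightarrow> p i j u \<in> {0..1}"
    and prob_sum: "\<lbrakk>i \<in> {1..n}; u \<in> A i\<rbrakk> \<Longrightarrow> (\<Sum>j\<in>{1..n}. p i j u) = 1"
    and discount: "0 < \<alpha>" "\<alpha> < 1"

definition stationary_policy :: "nat \<Rightarrow> (nat \<Rightarrow> 'u set) \<Rightarrow> (nat \<Rightarrow> 'u) \<Rightarrow> bool" where
  "stationary_policy n A \<mu> \<longleftrightarrow> (\<forall>i\<in>{1..n}. \<mu> i \<in> A i)"

text \<open>
  For \<open>i \<ge> 1\<close> the natural number \<open>(i - 1) div m\<close> is the floor of the real quotient.
\<close>

definition batch :: "nat \<Rightarrow> nat \<Rightarrow> nat set" where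
  "batch m i = {1..m * ((i - 1) div m)}"

lemma batch_less: "j \<in> batch m i \<Longrightarrow> j < i"
proof -
  assume "j \<in> batch m i"
  then have "1 \<le> j" and "j \<le> m * ((i - 1) div m)"
    by (auto simp: batch_def)
  moreover have "m * ((i - 1) div m) \<le> i - 1"
    by simp
  ultimately show "j < i"
    by linarith
qed

function minibatch_op ::
  "nat \<Rightarrow> (nat \<Rightarrow> 'u set) \<Rightarrow> (nat \<Rightarrow> nat \<Rightarrow> 'u \<Rightarrow> real) \<Rightarrow> (nat \<Rightarrow> 'u \<Rightarrow> real) \<Rightarrow> real \<Rightarrow> nat
    \<Rightarrow> (nat \<Rightarrow> real) \<Rightarrow> nat \<Rightarrow> real" where
  "minibatch_op n A p g \<alpha> m J i =
     (MIN u\<in>A i. g i u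
        + \<alpha> * (\<Sum>j\<in>{1..n} - batch m i. p i j u * J j)
        + \<alpha> * (\<Sum>j\<in>batch m i. p i j u * minibatch_op n A p g \<alpha> m J j))"
  by pat_completeness auto
termination
  by (relation "measure (\<lambda>(n, A, p, g, \<alpha>, m, J, i). i)") (auto dest: batch_less)

function minibatch_policy_op ::
  "nat \<Rightarrow> (nat \<Rightarrow> nat \<Rightarrow> 'u \<Rightarrow> real) \<Rightarrow> (nat \<Rightarrow> 'u \<Rightarrow> real) \<Rightarrow> real \<Rightarrow> (nat \<Rightarrow> 'u) \<Rightarrow> nat
    \<Rightarrow> (nat \<Rightarrow> real) \<Rightarrow> nat \<Rightarrow> real" where
  "minibatch_policy_op n p g \<alpha> \<mu> m J i =
     g i (\<mu> i)
       + \<alpha> * (\<Sum>j\<in>{1..n} - batch m i. p i j (\<mu> i) * J j)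
       + \<alpha> * (\<Sum>j\<in>batch m i. p i j (\<mu> i) * minibatch_policy_op n p g \<alpha> \<mu> m J j)"
  by pat_completeness auto
termination
  by (relation "measure (\<lambda>(n, p, g, \<alpha>, \<mu>, m, J, i). i)") (auto dest: batch_less)

text \<open>The recursion equations loop as unconditional rewrite rules.\<close>

declare minibatch_op.simps [simp del] minibatch_policy_op.simps [simp del]

end

theory Submission
  imports Defs
begin

text \<open>
  Both operators are built from one one-step backup, in which the costs-to-go of the successor
  states enter with the nonnegative weights \<open>\<alpha> * p i j u\<close>; the backup is therefore monotone in the
  old values \<open>J\<close> and in the already updated values jointly (\<open>backup_mono\<close>). Since the updated values
  used at state \<open>i\<close> belong to states below \<open>i\<close>, strong induction on the state supplies their
  inequality and shows that a single application preserves the pointwise order on \<open>{1..n}\<close>. For the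
  Bellman operator the minimum over a finite nonempty set of controls preserves the inequality as
  well. Iterating an order-preserving operator preserves the order.
\<close>

lemma Min_image_mono:
  fixes f h :: "'a \<Rightarrow> 'b::linorder"
  assumes "finite X" "X \<noteq> {}" "\<And>x. x \<in> X \<Longrightarrow> f x \<le> h x"
  shows "(MIN x\<in>X. f x) \<le> (MIN x\<in>X. h x)"
proof (rule Min.boundedI)
  fix y assume "y \<in> h ` X"
  then obtain x where x: "x \<in> X" "y = h x" by auto
  then have "(MIN x\<in>X. f x) \<le> f x" using assms(1) by simp
  also have "\<dots> \<le> y" using assms(3) x by simp
  finally show "(MIN x\<in>X. f x) \<le> y" .
qed (use assms in auto)

context mdp
begin

lemma backup_mono:
  assumes i: "i \<in> {1..n}" and u: "u \<in> A i"
    and old: "\<forall>j\<in>{1..n}. J j \<le> J' j"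
    and new: "\<And>j. j \<in> batch m i \<Longrightarrow> V j \<le> V' j"
  shows "g i u + \<alpha> * (\<Sum>j\<in>{1..n} - batch m i. p i j u * J j)
           + \<alpha> * (\<Sum>j\<in>batch m i. p i j u * V j)
         \<le> g i u + \<alpha> * (\<Sum>j\<in>{1..n} - batch m i. p i j u * J' j)
           + \<alpha> * (\<Sum>j\<in>batch m i. p i j u * V' j)"
proof -
  have nonneg: "0 \<le> p i j u" if "j \<in> {1..n}" for j
    using prob_range[OF i that u] by simp
  \<comment> \<open>The nonnegativity of \<open>p i j u\<close> is known for states \<open>j\<close> only, hence the batch must consist of states.\<close>
  have batch_states: "j \<in> {1..n}" if "j \<in> batch m i" for j
    using batch_less[OF that] that i by (auto simp: batch_def)
  have "(\<Sum>j\<in>{1..n} - batch m i. p i j u * J j) \<le> (\<Sum>j\<in>{1..n} - batch m i. p i j u * J' j)"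
    by (intro sum_mono mult_left_mono) (use old nonneg in auto)
  moreover have "(\<Sum>j\<in>batch m i. p i j u * V j) \<le> (\<Sum>j\<in>batch m i. p i j u * V' j)"
    by (intro sum_mono mult_left_mono new nonneg batch_states)
  ultimately show ?thesis
    using discount by (intro add_mono mult_left_mono) auto
qed

lemma minibatch_policy_op_mono:
  assumes policy: "stationary_policy n A \<mu>"
    and le: "\<forall>j\<in>{1..n}. J j \<le> J' j"
    and "i \<in> {1..n}"
  shows "minibatch_policy_op n p g \<alpha> \<mu> m J i \<le> minibatch_policy_op n p g \<alpha> \<mu> m J' i"
  using \<open>i \<in> {1..n}\<close>
proof (induction i rule: less_induct)
  case (less i)
  have "\<mu> i \<in> A i"
    using policy less.prems by (simp add: stationary_policy_def)
  moreover have "minibatch_policy_op n p g \<alpha> \<mu> m J j \<le> minibatch_policy_op n p g \<alpha> \<mu> m J' j"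
    if "j \<in> batch m i" for j
    using less batch_less[OF that] that by (auto simp: batch_def)
  ultimately show ?case
    unfolding minibatch_policy_op.simps[of n p g \<alpha> \<mu> m _ i]
    by (intro backup_mono less.prems le)
qed

lemma minibatch_op_mono:
  assumes le: "\<forall>j\<in>{1..n}. J j \<le> J' j"
    and "i \<in> {1..n}"
  shows "minibatch_op n A p g \<alpha> m J i \<le> minibatch_op n A p g \<alpha> m J' i"
  using \<open>i \<in> {1..n}\<close>
proof (induction i rule: less_induct)
  case (less i)
  have "finite (A i)"
    using available_subset[OF less.prems] finite_controls by (rule finite_subset)
  moreover have "A i \<noteq> {}"
    by (rule available_nonempty[OF less.prems])
  moreover have "minibatch_op n A p g \<alpha> m J j \<le> minibatch_op n A p g \<alpha> m J' j"
    if "j \<in> batch m i" for j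
    using less batch_less[OF that] that by (auto simp: batch_def)
  ultimately show ?case
    unfolding minibatch_op.simps[of n A p g \<alpha> m _ i]
    by (intro Min_image_mono backup_mono less.prems le)
qed

end

text \<open>
  The order is compared on \<open>S\<close> only, because the operators are monotone just on the state space, not
  for the pointwise order on all functions of type \<^typ>\<open>nat \<Rightarrow> real\<close>.
\<close>

lemma funpow_mono_on:
  fixes F :: "('a \<Rightarrow> 'b::order) \<Rightarrow> 'a \<Rightarrow> 'b"
  assumes step: "\<And>J J' i. \<forall>j\<in>S. J j \<le> J' j \<Longrightarrow> i \<in> S \<Longrightarrow> F J i \<le> F J' i"
    and le: "\<forall>j\<in>S. J j \<le> J' j"
  shows "\<forall>i\<in>S. (F ^^ k) J i \<le> (F ^^ k) J' i"
  by (induction k) (auto simp: le intro: step)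

theorem mainTheorem5:
  fixes n m :: nat
    and U :: "'u set"
    and A :: "nat \<Rightarrow> 'u set"
    and p :: "nat \<Rightarrow> nat \<Rightarrow> 'u \<Rightarrow> real"
    and g :: "nat \<Rightarrow> 'u \<Rightarrow> real"
    and \<alpha> :: real
    and J J' :: "nat \<Rightarrow> real"
    and \<mu> :: "nat \<Rightarrow> 'u"
  assumes "mdp n U A p \<alpha>"
    and "1 \<le> m" and "m \<le> n"
    and "stationary_policy n A \<mu>"
    and "\<forall>i\<in>{1..n}. J i \<le> J' i"
  shows "\<forall>k\<ge>1. \<forall>i\<in>{1..n}.
           (minibatch_op n A p g \<alpha> m ^^ k) J i \<le> (minibatch_op n A p g \<alpha> m ^^ k) J' i \<and>
           (minibatch_policy_op n p g \<alpha> \<mu> m ^^ k) J i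
             \<le> (minibatch_policy_op n p g \<alpha> \<mu> m ^^ k) J' i"
proof -
  interpret mdp n U A p g \<alpha> by (rule assms(1))
  have "\<forall>i\<in>{1..n}. (minibatch_op n A p g \<alpha> m ^^ k) J i \<le> (minibatch_op n A p g \<alpha> m ^^ k) J' i" for k
    by (rule funpow_mono_on[OF _ assms(5)]) (rule minibatch_op_mono)
  moreover have "\<forall>i\<in>{1..n}. (minibatch_policy_op n p g \<alpha> \<mu> m ^^ k) J i
      \<le> (minibatch_policy_op n p g \<alpha> \<mu> m ^^ k) J' i" for k
    by (rule funpow_mono_on[OF _ assms(5)]) (rule minibatch_policy_op_mono[OF assms(4)])
  ultimately show ?thesis by blast
qed

end
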